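(* Let $r$ be a revenue profile as in the context. The optimal threshold $\eta^{\mathrm{opt}}$ increases in $\gamma\in\mathbb{R}$, and $R_{\mathrm T}(\eta^{\mathrm{opt}})$ decreases in $\gamma\in\mathbb{R}$.
   Context: $\phi,\Phi$ are the standard normal density and distribution function. The revenue profile $r:\mathbb{R}\to\mathbb{R}$ (not depending on $\gamma$) is piecewise smooth and bounded on $(-\infty,0)$ and $(0,\infty)$, and continuous at $0$ with $r(\pm0)=1=r(0)$; it is increasing on $(-\infty,0]$ and decreasing on $[0,\infty)$, with $0\le r(x)\le r(0)=1$. For $\gamma\in\mathbb{R}$ and measurable $f:[0,\infty)\to[0,1]$ with $\int_0^\infty f(x)e^{-\gamma x}\,dx<\infty$, let $$R(f)=\frac{\int_{-\infty}^0 r(x)e^{-\frac12x^2-\gamma x}\,dx+\int_0^\infty r(x)f(x)e^{-\gamma x}\,dx}{\frac{\Phi(\gamma)}{\phi(\gamma)}+\int_0^\infty f(x)e^{-\gamma x}\,dx},$$ and for $\eta\ge0$ let $R_{\mathrm T}(\eta)=R(\mathbf{1}[0\le x<\eta])$, that is, $$R_{\mathrm T}(\eta)=\frac{\int_{-\infty}^0 r(x)e^{-\frac12x^2-\gamma x}\,dx+\int_0^\eta r(x)e^{-\gamma x}\,dx}{\frac{\Phi(\gamma)}{\phi(\gamma)}+\int_0^\eta e^{-\gamma x}\,dx}.$$ The optimal threshold $\eta^{\mathrm{opt}}=\eta^{\mathrm{opt}}(\gamma)$ is the threshold for which $f(x)=\mathbf{1}[0\le x<\eta^{\mathrm{opt}}]$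 maximizes $R(f)$; it is a solution $\eta\ge0$ of the threshold equation $r(\eta)=R_{\mathrm T}(\eta)$ if $r(0)>R_{\mathrm T}(0)$, and $\eta^{\mathrm{opt}}=0$ if $r(0)\le R_{\mathrm T}(0)$. *)

theory Defs
  imports "HOL-Probability.Probability"
begin

text \<open>
  Only local finiteness of the set of break points is required, so infinitely many pieces and
  jumps at break points are allowed; nothing is asked of the one-sided limits of the derivative.
\<close>
definition piecewise_smooth_on :: "(real \<Rightarrow> real) \<Rightarrow> real set \<Rightarrow> bool" where
  "piecewise_smooth_on r A \<longleftrightarrow>
     (\<exists>S. (\<forall>K. compact K \<and> K \<subseteq> A \<longrightarrow> finite (S \<inter> K)) \<and> r C1_differentiable_on (A - S))"

definition revenue_profile :: "(real \<Rightarrow> real) \<Rightarrow> bool" where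
  "revenue_profile r \<longleftrightarrow>
     piecewise_smooth_on r {..<0} \<and> piecewise_smooth_on r {0<..} \<and>
     bounded (r ` {..<0}) \<and> bounded (r ` {0<..}) \<and>
     (r \<longlongrightarrow> 1) (at_left 0) \<and> (r \<longlongrightarrow> 1) (at_right 0) \<and> r 0 = 1 \<and>
     mono_on {..0} r \<and> antimono_on {0..} r \<and>
     (\<forall>x. 0 \<le> r x \<and> r x \<le> r 0)"

text \<open>Controls are functions on \<open>[0, \<infinity>)\<close>; their values at negative arguments are irrelevant.\<close>
definition admissible_controls :: "real \<Rightarrow> (real \<Rightarrow> real) set" where
  "admissible_controls \<gamma> =
     {f. set_borel_measurable lborel {0..} f \<and> (\<forall>x\<ge>0. 0 \<le> f x \<and> f x \<le> 1) \<and>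
         set_integrable lborel {0..} (\<lambda>x. f x * exp (- \<gamma> * x))}"

definition revenue :: "(real \<Rightarrow> real) \<Rightarrow> real \<Rightarrow> (real \<Rightarrow> real) \<Rightarrow> real" where
  "revenue r \<gamma> f =
     ((LINT x:{..0}|lborel. r x * exp (- x\<^sup>2 / 2 - \<gamma> * x)) +
      (LINT x:{0..}|lborel. r x * f x * exp (- \<gamma> * x))) /
     (cdf std_normal_distribution \<gamma> / std_normal_density \<gamma> +
      (LINT x:{0..}|lborel. f x * exp (- \<gamma> * x)))"

definition threshold_revenue :: "(real \<Rightarrow> real) \<Rightarrow> real \<Rightarrow> real \<Rightarrow> real" where
  "threshold_revenue r \<gamma> \<eta> = revenue r \<gamma> (indicator {0..<\<eta>})"

lemma threshold_revenue_eq: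
  "threshold_revenue r \<gamma> \<eta> =
     ((LINT x:{..0}|lborel. r x * exp (- x\<^sup>2 / 2 - \<gamma> * x)) +
      (LINT x:{0..<\<eta>}|lborel. r x * exp (- \<gamma> * x))) /
     (cdf std_normal_distribution \<gamma> / std_normal_density \<gamma> +
      (LINT x:{0..<\<eta>}|lborel. exp (- \<gamma> * x)))"
proof -
  have "(LINT x:{0..}|lborel. r x * indicator {0..<\<eta>} x * exp (- \<gamma> * x)) =
      (LINT x:{0..<\<eta>}|lborel. r x * exp (- \<gamma> * x))"
    unfolding set_lebesgue_integral_def
    by (rule Bochner_Integration.integral_cong) (auto simp: indicator_def)
  moreover have "(LINT x:{0..}|lborel. indicator {0..<\<eta>} x * exp (- \<gamma> * x)) =
      (LINT x:{0..<\<eta>}|lborel. exp (- \<gamma> * x))"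
    unfolding set_lebesgue_integral_def
    by (rule Bochner_Integration.integral_cong) (auto simp: indicator_def)
  ultimately show ?thesis
    by (simp add: threshold_revenue_def revenue_def)
qed

text \<open>
  If \<open>r 0 \<le> threshold_revenue r \<gamma> 0\<close>, every threshold up to which \<open>r\<close> equals \<open>1\<close> is a maximizer;
  the last conjunct then selects \<open>0\<close>.  A profile with jumps may have an optimal threshold that
  does not solve \<open>r \<eta> = threshold_revenue r \<gamma> \<eta>\<close>, and that equation is not imposed here.
\<close>
definition optimal_threshold :: "(real \<Rightarrow> real) \<Rightarrow> real \<Rightarrow> real \<Rightarrow> bool" where
  "optimal_threshold r \<gamma> \<eta> \<longleftrightarrow>
     0 \<le> \<eta> \<and>
     (\<forall>f \<in> admissible_controls \<gamma>. revenue r \<gamma> f \<le> revenue r \<gamma> (indicator {0..<\<eta>})) \<and>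
     (r 0 \<le> threshold_revenue r \<gamma> 0 \<longrightarrow> \<eta> = 0)"

lemma cdf_pos: "0 < cdf std_normal_distribution x"
proof -
  interpret prob_space std_normal_distribution by (rule prob_space_normal_density) simp
  have "emeasure std_normal_distribution {..x} \<noteq> 0"
  proof
    assume "emeasure std_normal_distribution {..x} = 0"
    then have "(\<integral>\<^sup>+ y. ennreal (std_normal_density y) * indicator {..x} y \<partial>lborel) = 0"
      by (simp add: emeasure_density)
    then have "AE y in lborel. ennreal (std_normal_density y) * indicator {..x} y = 0"
      by (subst (asm) nn_integral_0_iff_AE) auto
    moreover have "std_normal_density y > 0" for y by (simp add: normal_density_pos)
    ultimately have "AE y in lborel. y \<notin> {..x}"
      by (auto simp: indicator_def  elim!: eventually_mono split: if_splits)
         (metis less_irrefl)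
    then have "emeasure lborel {..x} = 0"
      by (subst (asm) AE_iff_measurable[of "{..x}"]) auto
    moreover have "emeasure lborel {x-1..x} \<le> emeasure lborel {..x}"
      by (intro emeasure_mono) auto
    ultimately show False by simp
  qed
  then show ?thesis by (simp add: cdf_def emeasure_eq_measure zero_less_measure_iff)
qed

lemma optimal_threshold_if_threshold_equation:
  assumes r: "revenue_profile r" and "0 \<le> \<eta>" "threshold_revenue r \<gamma> 0 < r 0"
    and eq: "r \<eta> = threshold_revenue r \<gamma> \<eta>"
  shows "optimal_threshold r \<gamma> \<eta>"
proof -
  define A where "A = (LINT x:{..0}|lborel. r x * exp (- x\<^sup>2 / 2 - \<gamma> * x))"
  define B where "B = cdf std_normal_distribution \<gamma> / std_normal_density \<gamma>"
  define D where "D f = (LINT x:{0..}|lborel. f x * exp (- \<gamma> * x))" for f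
  define N where "N f = (LINT x:{0..}|lborel. r x * f x * exp (- \<gamma> * x))" for f
  have rev: "revenue r \<gamma> f = (A + N f) / (B + D f)" for f
    by (simp add: revenue_def A_def B_def D_def N_def)
  have B: "B > 0" unfolding B_def by (simp add: cdf_pos normal_density_pos)
  have anti: "r y \<le> r x" if "0 \<le> x" "x \<le> y" for x y
    using r that by (auto simp: revenue_profile_def monotone_on_def)
  have r01: "0 \<le> r x" "r x \<le> 1" for x using r by (auto simp: revenue_profile_def)
  have "mono (\<lambda>x. - r (max 0 x))" by (auto simp: mono_def intro!: anti)
  then have "(\<lambda>x. - r (max 0 x)) \<in> borel_measurable borel" by (rule borel_measurable_mono)
  then have rmeas: "(\<lambda>x. r (max 0 x)) \<in> borel_measurable borel"
    using borel_measurable_uminus_eq by blast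
  have intN: "set_integrable lborel {0..} (\<lambda>x. r x * f x * exp (- \<gamma> * x))"
    if "set_integrable lborel {0..} (\<lambda>x. f x * exp (- \<gamma> * x))" for f
  proof -
    have "integrable lborel (\<lambda>x. r (max 0 x) * (indicator {0..} x *\<^sub>R (f x * exp (- \<gamma> * x))))"
    proof (rule Bochner_Integration.integrable_bound)
      show "integrable lborel (\<lambda>x. indicator {0..} x *\<^sub>R (f x * exp (- \<gamma> * x)))"
        using that by (simp add: set_integrable_def)
      show "(\<lambda>x. r (max 0 x) * (indicator {0..} x *\<^sub>R (f x * exp (- \<gamma> * x)))) \<in> borel_measurable lborel"
        by (rule borel_measurable_times[OF _ borel_measurable_integrable])
           (use rmeas that in \<open>auto simp: set_integrable_def\<close>)
      show "AE x in lborel. norm (r (max 0 x) * (indicator {0..} x *\<^sub>R (f x * exp (- \<gamma> * x))))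
          \<le> norm (indicator {0..} x *\<^sub>R (f x * exp (- \<gamma> * x)))"
        using r01 by (auto simp: abs_mult intro!: mult_left_le_one_le)
    qed
    then show ?thesis unfolding set_integrable_def
      by (rule Bochner_Integration.integrable_cong[THEN iffD1, rotated -1]) (auto simp: indicator_def)
  qed
  have Dnn: "D f \<ge> 0" if "\<forall>x\<ge>0. 0 \<le> f x" for f
    unfolding D_def set_lebesgue_integral_def using that
    by (intro Bochner_Integration.integral_nonneg) (auto simp: indicator_def)
  let ?t = "indicator {0..<\<eta>} :: real \<Rightarrow> real"
  have tint: "set_integrable lborel {0..} (\<lambda>x. ?t x * exp (- \<gamma> * x))"
  proof -
    have "set_integrable lborel {0..\<eta>} (\<lambda>x. exp (- \<gamma> * x))"
      by (intro borel_integrable_atLeastAtMost') (auto intro!: continuous_intros)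
    then have "set_integrable lborel {0..<\<eta>} (\<lambda>x. exp (- \<gamma> * x))"
      by (rule set_integrable_subset) auto
    then show ?thesis unfolding set_integrable_def
      by (rule Bochner_Integration.integrable_cong[THEN iffD1, rotated -1]) (auto simp: indicator_def)
  qed
  have teq: "A + N ?t = r \<eta> * (B + D ?t)"
    using eq B Dnn[of ?t] by (simp add: threshold_revenue_def rev field_simps)
  have "revenue r \<gamma> f \<le> r \<eta>" if f: "f \<in> admissible_controls \<gamma>" for f
  proof -
    have f01: "0 \<le> f x" "f x \<le> 1" if "x \<ge> 0" for x using f that by (auto simp: admissible_controls_def)
    have fi: "set_integrable lborel {0..} (\<lambda>x. f x * exp (- \<gamma> * x))"
      using f by (auto simp: admissible_controls_def)
    have ex: "N g - r \<eta> * D g = (LINT x:{0..}|lborel. r x * g x * exp (- \<gamma> * x) - r \<eta> * (g x * exp (- \<gamma> * x)))"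
      and ex': "set_integrable lborel {0..} (\<lambda>x. r x * g x * exp (- \<gamma> * x) - r \<eta> * (g x * exp (- \<gamma> * x)))"
      if "set_integrable lborel {0..} (\<lambda>x. g x * exp (- \<gamma> * x))" for g
      using intN[OF that] that unfolding N_def D_def
      by (simp_all add: set_integral_diff)
    have "N f - r \<eta> * D f \<le> N ?t - r \<eta> * D ?t"
      unfolding ex[OF fi] ex[OF tint]
    proof (rule set_integral_mono[OF ex'[OF fi] ex'[OF tint]])
      fix x :: real assume "x \<in> {0..}"
      then have x: "x \<ge> 0" by simp
      have "(r x - r \<eta>) * f x \<le> (r x - r \<eta>) * ?t x"
      proof (cases "x < \<eta>")
        case True
        then have "r x \<ge> r \<eta>" using anti x by simp
        then show ?thesis using True x f01(2)[OF x] by (simp add: mult_left_le)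
      next
        case False
        then have "r x \<le> r \<eta>" using anti \<open>0 \<le> \<eta>\<close> by simp
        then show ?thesis using False f01(1)[OF x] by (simp add: mult_nonpos_nonneg)
      qed
      then have "(r x - r \<eta>) * f x * exp (- \<gamma> * x) \<le> (r x - r \<eta>) * ?t x * exp (- \<gamma> * x)"
        by (intro mult_right_mono) auto
      then show "r x * f x * exp (- \<gamma> * x) - r \<eta> * (f x * exp (- \<gamma> * x))
          \<le> r x * ?t x * exp (- \<gamma> * x) - r \<eta> * (?t x * exp (- \<gamma> * x))"
        by (simp add: algebra_simps)
    qed
    then have "A + N f \<le> r \<eta> * (B + D f)" using teq by (simp add: algebra_simps)
    then show ?thesis using B Dnn[of f] f01 by (simp add: rev field_simps)
  qed
  then show ?thesis using assms by (auto simp: optimal_threshold_def threshold_revenue_def)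
qed
end

theory Submission
  imports Defs
begin

text \<open>
  The ratio \<open>\<Phi>(\<gamma>) / \<phi>(\<gamma>)\<close> is the integral of \<open>exp (- x\<^sup>2 / 2 - \<gamma> x)\<close> over the negative
  half-line.  Hence \<open>R\<^sub>T(\<eta>)\<close> is an average of \<open>r\<close> over \<open>(- \<infinity>, \<eta>)\<close>, with weight
  \<open>exp (- min(x, 0)\<^sup>2 / 2)\<close> tilted by the factor \<open>exp (- \<gamma> x)\<close>.  Raising \<open>\<gamma>\<close> moves mass to the left.
  Write \<open>\<rho>\<close> for the optimal revenue at \<open>\<gamma>\<close>, attained at \<open>\<eta>\<close>.

  The average of \<open>r - \<rho>\<close> over \<open>(- \<infinity>, \<eta>)\<close> vanishes, and optimality forces \<open>r \<ge> \<rho>\<close> on \<open>[0, \<eta>)\<close>,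
  because cutting off a stretch with \<open>r < \<rho>\<close> would raise the average
  (\<open>profile_ge_optimal_revenue\<close>).  As \<open>r\<close> increases on the negative half-line, \<open>r - \<rho>\<close> changes sign
  at most once on \<open>(- \<infinity>, \<eta>)\<close>, from negative to positive.  Undoing some of the tilt, that is passing
  to a smaller parameter, multiplies the weight by an increasing exponential, which favours the
  positive part: the same threshold \<open>\<eta>\<close> earns more than \<open>\<rho>\<close> there, and the optimal threshold earns
  at least as much (\<open>optimal_revenue_strict_decreasing\<close>).

  So the optimal revenue decreases strictly in \<open>\<gamma>\<close>.  Then the optimal threshold increases: where \<open>r\<close>
  reaches the old revenue it exceeds the new one, so the new threshold cannot stop earlier
  (\<open>optimal_threshold_le_if_revenue_less\<close>).  Strictness needs some loss \<open>r < 1\<close> on the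
  negative half-line.  Without it \<open>R\<^sub>T(0) = 1 = r(0)\<close> for every \<open>\<gamma>\<close>, the optimal threshold is \<open>0\<close> by
  convention, and both functions are constant.
\<close>

section \<open>Threshold revenue as a tilted average\<close>

definition tilted_weight :: "real \<Rightarrow> real \<Rightarrow> real" where
  "tilted_weight \<gamma> x = exp (- (min x 0)\<^sup>2 / 2 - \<gamma> * x)"

lemma tilted_weight_pos: "0 < tilted_weight \<gamma> x"
  by (simp add: tilted_weight_def)

lemma tilted_weight_shift:
  "tilted_weight \<gamma> x = tilted_weight \<gamma>' x * exp ((\<gamma>' - \<gamma>) * x)"
  by (simp add: tilted_weight_def flip: exp_add) (simp add: algebra_simps)

lemma std_normal_density_shift:
  "std_normal_density (\<gamma> + x) = std_normal_density \<gamma> * exp (- x\<^sup>2 / 2 - \<gamma> * x)"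
  by (simp add: normal_density_def flip: exp_add) (simp add: power2_eq_square field_simps)

text \<open>Substituting \<open>y = \<gamma> + x\<close> in the integral of the normal density over \<open>(- \<infinity>, \<gamma>]\<close>.\<close>
lemma mills_ratio:
  shows "set_integrable lborel {..0} (\<lambda>x. exp (- x\<^sup>2 / 2 - \<gamma> * x))"
    and "cdf std_normal_distribution \<gamma> / std_normal_density \<gamma> =
      (LINT x:{..0}|lborel. exp (- x\<^sup>2 / 2 - \<gamma> * x))"
proof -
  have pos: "std_normal_density \<gamma> > 0"
    by (simp add: normal_density_pos)
  \<comment> \<open>The factor \<open>1\<close> fits the affine substitution rules for the Lebesgue measure.\<close>
  have eq: "indicator {..\<gamma>} (\<gamma> + 1 * x) *\<^sub>R std_normal_density (\<gamma> + 1 * x) =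
      std_normal_density \<gamma> * (indicator {..0} x *\<^sub>R exp (- x\<^sup>2 / 2 - \<gamma> * x))" for x
    by (simp add: std_normal_density_shift indicator_def)
  have int: "integrable lborel (\<lambda>x. indicator {..\<gamma>} x *\<^sub>R std_normal_density x)"
    by (rule integrable_mult_indicator) auto
  then have "integrable lborel (\<lambda>x. indicator {..\<gamma>} (\<gamma> + 1 * x) *\<^sub>R std_normal_density (\<gamma> + 1 * x))"
    by (rule lborel_integrable_real_affine) simp
  then show "set_integrable lborel {..0} (\<lambda>x. exp (- x\<^sup>2 / 2 - \<gamma> * x))"
    unfolding set_integrable_def eq using pos by simp
  have "cdf std_normal_distribution \<gamma> = (LINT x|std_normal_distribution. indicator {..\<gamma>} x)"
    by (simp add: cdf_def)
  also have "\<dots> = (LINT x|lborel. std_normal_density x * indicator {..\<gamma>} x)"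
    by (subst integral_real_density) auto
  also have "\<dots> = (LINT x|lborel. indicator {..\<gamma>} x *\<^sub>R std_normal_density x)"
    by (simp add: mult.commute)
  also have "\<dots> = (LINT x|lborel. indicator {..\<gamma>} (\<gamma> + 1 * x) *\<^sub>R std_normal_density (\<gamma> + 1 * x))"
    by (subst lborel_integral_real_affine[where c = 1 and t = \<gamma>]) auto
  also have "\<dots> = std_normal_density \<gamma> * (LINT x:{..0}|lborel. exp (- x\<^sup>2 / 2 - \<gamma> * x))"
    unfolding eq set_lebesgue_integral_def by (rule integral_mult_right_zero)
  finally show "cdf std_normal_distribution \<gamma> / std_normal_density \<gamma> =
      (LINT x:{..0}|lborel. exp (- x\<^sup>2 / 2 - \<gamma> * x))"
    using pos by simp
qed

text \<open>The two pieces share the point \<open>0\<close>, a null set.\<close>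
lemma set_integral_split_at_zero:
  fixes f :: "real \<Rightarrow> real"
  assumes "0 \<le> \<eta>" "set_integrable lborel {..0} f" "set_integrable lborel {0..<\<eta>} f"
  shows "set_integrable lborel {..<\<eta>} f"
    and "(LINT x:{..<\<eta>}|lborel. f x) = (LINT x:{..0}|lborel. f x) + (LINT x:{0..<\<eta>}|lborel. f x)"
proof -
  have lt: "set_integrable lborel {..<0} f"
    by (rule set_integrable_subset[OF assms(2)]) auto
  have un: "{..<\<eta>} = {..<0} \<union> {0..<\<eta>}" using assms(1) by auto
  show "set_integrable lborel {..<\<eta>} f"
    unfolding un by (rule set_integrable_Un[OF lt assms(3)]) auto
  have "(LINT x:{..0}|lborel. f x) = (LINT x:{..<0}|lborel. f x)"
  proof (rule set_integral_cong_set)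
    show "AE x in lborel. (x \<in> {..<0}) = (x \<in> {..0::real})"
      using AE_lborel_singleton[of "0::real"] by eventually_elim auto
  qed (use assms(2) lt in \<open>auto simp: set_integrable_def set_borel_measurable_def\<close>)
  then show "(LINT x:{..<\<eta>}|lborel. f x) = (LINT x:{..0}|lborel. f x) + (LINT x:{0..<\<eta>}|lborel. f x)"
    unfolding un by (subst set_integral_Un[OF _ lt assms(3)]) auto
qed

lemma set_integrable_exp_Ico: "set_integrable lborel {0..<\<eta>} (\<lambda>x::real. exp (- \<gamma> * x))"
proof -
  have "set_integrable lborel {0..\<eta>} (\<lambda>x. exp (- \<gamma> * x))"
    by (intro borel_integrable_atLeastAtMost') (auto intro!: continuous_intros)
  then show ?thesis
    by (rule set_integrable_subset) auto
qed

lemma set_integral_pos_if_pos_on_interval: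
  fixes f :: "real \<Rightarrow> real"
  assumes "set_integrable lborel S f" "\<And>x. x \<in> S \<Longrightarrow> 0 \<le> f x"
    and "a < b" "{a<..<b} \<subseteq> S" "\<And>x. a < x \<Longrightarrow> x < b \<Longrightarrow> 0 < f x"
  shows "0 < (LINT x:S|lborel. f x)"
proof -
  let ?F = "\<lambda>x. indicator S x *\<^sub>R f x"
  have int: "integrable lborel ?F"
    using assms(1) by (simp add: set_integrable_def)
  have nonneg: "0 \<le> ?F x" for x
    using assms(2) by (auto simp: indicator_def)
  have "\<not> (AE x in lborel. ?F x = 0)"
  proof
    assume "AE x in lborel. ?F x = 0"
    then have "AE x in lborel. x \<notin> {a<..<b}"
      using assms(4,5) by (auto elim!: eventually_mono simp: indicator_def) (metis less_irrefl)
    then have "emeasure lborel {a<..<b} = 0"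
      by (subst (asm) AE_iff_measurable[of "{a<..<b}"]) auto
    with \<open>a < b\<close> show False by simp
  qed
  then have "integral\<^sup>L lborel ?F \<noteq> 0"
    using integral_nonneg_eq_0_iff_AE[OF int] nonneg by auto
  moreover have "0 \<le> integral\<^sup>L lborel ?F"
    using nonneg by (rule Bochner_Integration.integral_nonneg)
  ultimately show ?thesis
    by (simp add: set_lebesgue_integral_def)
qed

lemma indicator_admissible: "indicator {0..<\<eta>} \<in> admissible_controls \<gamma>"
proof -
  have "set_integrable lborel {0..} (\<lambda>x. indicator {0..<\<eta>} x * exp (- \<gamma> * x))"
    using set_integrable_exp_Ico[of \<eta> \<gamma>] unfolding set_integrable_def
    by (rule Bochner_Integration.integrable_cong[THEN iffD1, rotated -1]) (auto simp: indicator_def)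
  then show ?thesis
    by (auto simp: admissible_controls_def set_borel_measurable_def)
qed

lemma optimal_threshold_maximal:
  assumes "optimal_threshold r \<gamma> \<eta>"
  shows "threshold_revenue r \<gamma> \<eta>' \<le> threshold_revenue r \<gamma> \<eta>"
  using assms indicator_admissible by (auto simp: optimal_threshold_def threshold_revenue_def)

text \<open>
  The sign of this integral compares a threshold revenue with a level \<open>\<rho>\<close>, and unlike the revenue
  itself it is additive over pieces of the domain and linear in the weight.
\<close>
definition excess_revenue :: "(real \<Rightarrow> real) \<Rightarrow> real \<Rightarrow> real \<Rightarrow> real \<Rightarrow> real" where
  "excess_revenue r \<gamma> \<rho> \<eta> = (LINT x:{..<\<eta>}|lborel. (r x - \<rho>) * tilted_weight \<gamma> x)"

lemma tilted_weight_cases: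
  "x \<le> 0 \<Longrightarrow> tilted_weight \<gamma> x = exp (- x\<^sup>2 / 2 - \<gamma> * x)"
  "0 \<le> x \<Longrightarrow> tilted_weight \<gamma> x = exp (- \<gamma> * x)"
  by (auto simp: tilted_weight_def min_absorb1 min_absorb2)

lemma tilted_weight_integrable_pieces:
  "set_integrable lborel {..0} (tilted_weight \<gamma>)"
  "set_integrable lborel {0..<\<eta>} (tilted_weight \<gamma>)"
proof -
  show "set_integrable lborel {..0} (tilted_weight \<gamma>)"
    using mills_ratio(1)[of \<gamma>] by (subst set_integrable_cong) (auto simp: tilted_weight_cases)
  show "set_integrable lborel {0..<\<eta>} (tilted_weight \<gamma>)"
    using set_integrable_exp_Ico[of \<eta> \<gamma>] by (subst set_integrable_cong) (auto simp: tilted_weight_cases)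
qed

lemma tilted_weight_integrable:
  "0 \<le> \<eta> \<Longrightarrow> set_integrable lborel {..<\<eta>} (tilted_weight \<gamma>)"
  by (intro set_integral_split_at_zero(1) tilted_weight_integrable_pieces)

lemma tilted_weight_integral_pos:
  assumes "0 \<le> \<eta>"
  shows "0 < (LINT x:{..<\<eta>}|lborel. tilted_weight \<gamma> x)"
  using assms
  by (intro set_integral_pos_if_pos_on_interval[where a = "-1" and b = 0] tilted_weight_integrable)
     (auto simp: tilted_weight_pos less_imp_le)

section \<open>Comparing threshold revenues\<close>

locale unimodal_profile =
  fixes r :: "real \<Rightarrow> real"
  assumes profile: "revenue_profile r"
begin

lemma r_zero: "r 0 = 1" and r_nonneg: "0 \<le> r x" and r_le_1: "r x \<le> 1"
  using profile by (auto simp: revenue_profile_def)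

lemma r_mono: "x \<le> y \<Longrightarrow> y \<le> 0 \<Longrightarrow> r x \<le> r y"
  and r_antimono: "0 \<le> x \<Longrightarrow> x \<le> y \<Longrightarrow> r y \<le> r x"
  using profile by (auto simp: revenue_profile_def monotone_on_def)

text \<open>Glue the two monotone halves, both equal to \<open>1\<close> on the other side of \<open>0\<close>.\<close>
lemma r_borel_measurable: "r \<in> borel_measurable borel"
proof -
  have "mono (\<lambda>x. r (min x 0))"
    by (auto simp: mono_def intro!: r_mono)
  then have neg: "(\<lambda>x. r (min x 0)) \<in> borel_measurable borel"
    by (rule borel_measurable_mono)
  have "mono (\<lambda>x. - r (max x 0))"
    by (auto simp: mono_def intro!: r_antimono)
  then have pos: "(\<lambda>x. - r (max x 0)) \<in> borel_measurable borel"
    by (rule borel_measurable_mono)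
  have "r = (\<lambda>x. r (min x 0) - (- r (max x 0)) - 1)"
    by (auto simp: fun_eq_iff min_def max_def r_zero)
  also have "\<dots> \<in> borel_measurable borel"
    using neg pos by measurable
  finally show ?thesis .
qed

lemma profile_times_integrable:
  assumes "set_integrable lborel S g"
  shows "set_integrable lborel S (\<lambda>x. r x * g x)"
proof -
  have "integrable lborel (\<lambda>x. r x * (indicator S x *\<^sub>R g x))"
  proof (rule Bochner_Integration.integrable_bound)
    show gi: "integrable lborel (\<lambda>x. indicator S x *\<^sub>R g x)"
      using assms by (simp add: set_integrable_def)
    show "(\<lambda>x. r x * (indicator S x *\<^sub>R g x)) \<in> borel_measurable lborel"
      using r_borel_measurable borel_measurable_integrable[OF gi] by measurable
    show "AE x in lborel. norm (r x * (indicator S x *\<^sub>R g x)) \<le> norm (indicator S x *\<^sub>R g x)"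
      using r_nonneg r_le_1 by (auto simp: abs_mult intro!: mult_left_le_one_le)
  qed
  then show ?thesis by (simp add: set_integrable_def mult.left_commute)
qed

lemma excess_integrable:
  assumes "0 \<le> \<eta>"
  shows "set_integrable lborel {..<\<eta>} (\<lambda>x. (r x - \<rho>) * tilted_weight \<gamma> x)"
  unfolding left_diff_distrib
  by (intro set_integral_diff set_integrable_mult_right profile_times_integrable
      tilted_weight_integrable assms)

lemma threshold_revenue_average:
  assumes "0 \<le> \<eta>"
  shows "threshold_revenue r \<gamma> \<eta> =
    (LINT x:{..<\<eta>}|lborel. r x * tilted_weight \<gamma> x) / (LINT x:{..<\<eta>}|lborel. tilted_weight \<gamma> x)"
proof -
  note pieces = tilted_weight_integrable_pieces(1)[of \<gamma>] tilted_weight_integrable_pieces(2)[of \<eta> \<gamma>]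
  have "(LINT x:{..0}|lborel. r x * exp (- x\<^sup>2 / 2 - \<gamma> * x)) = (LINT x:{..0}|lborel. r x * tilted_weight \<gamma> x)"
    "(LINT x:{0..<\<eta>}|lborel. r x * exp (- \<gamma> * x)) = (LINT x:{0..<\<eta>}|lborel. r x * tilted_weight \<gamma> x)"
    "(LINT x:{..0}|lborel. exp (- x\<^sup>2 / 2 - \<gamma> * x)) = (LINT x:{..0}|lborel. tilted_weight \<gamma> x)"
    "(LINT x:{0..<\<eta>}|lborel. exp (- \<gamma> * x)) = (LINT x:{0..<\<eta>}|lborel. tilted_weight \<gamma> x)"
    by (auto intro!: set_lebesgue_integral_cong simp: tilted_weight_cases)
  then show ?thesis
    unfolding threshold_revenue_eq mills_ratio(2)
      set_integral_split_at_zero(2)[OF assms pieces]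
      set_integral_split_at_zero(2)[OF assms pieces[THEN profile_times_integrable]]
    by simp
qed

lemma excess_revenue_eq:
  assumes "0 \<le> \<eta>"
  shows "excess_revenue r \<gamma> \<rho> \<eta> =
    (threshold_revenue r \<gamma> \<eta> - \<rho>) * (LINT x:{..<\<eta>}|lborel. tilted_weight \<gamma> x)"
proof -
  have "excess_revenue r \<gamma> \<rho> \<eta> = (LINT x:{..<\<eta>}|lborel. r x * tilted_weight \<gamma> x)
      - \<rho> * (LINT x:{..<\<eta>}|lborel. tilted_weight \<gamma> x)"
    unfolding excess_revenue_def left_diff_distrib
    by (subst set_integral_diff)
       (auto intro!: set_integrable_mult_right profile_times_integrable tilted_weight_integrable assms)
  then show ?thesis
    using tilted_weight_integral_pos[OF assms, of \<gamma>]
    by (simp add: threshold_revenue_average[OF assms] left_diff_distrib)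
qed

lemma excess_revenue_pos_iff:
  assumes "0 \<le> \<eta>"
  shows "0 < excess_revenue r \<gamma> \<rho> \<eta> \<longleftrightarrow> \<rho> < threshold_revenue r \<gamma> \<eta>"
  using tilted_weight_integral_pos[OF assms, of \<gamma>]
  by (simp add: excess_revenue_eq[OF assms] zero_less_mult_iff)

lemma excess_revenue_self:
  assumes "0 \<le> \<eta>"
  shows "excess_revenue r \<gamma> (threshold_revenue r \<gamma> \<eta>) \<eta> = 0"
  by (simp add: excess_revenue_eq[OF assms])

lemma excess_revenue_split:
  assumes "0 \<le> a" "a \<le> b"
  shows "excess_revenue r \<gamma> \<rho> b = excess_revenue r \<gamma> \<rho> a
    + (LINT x:{a..<b}|lborel. (r x - \<rho>) * tilted_weight \<gamma> x)"
    and "set_integrable lborel {a..<b} (\<lambda>x. (r x - \<rho>) * tilted_weight \<gamma> x)"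
proof -
  have b: "set_integrable lborel {..<b} (\<lambda>x. (r x - \<rho>) * tilted_weight \<gamma> x)"
    using assms by (intro excess_integrable) simp
  then show i: "set_integrable lborel {a..<b} (\<lambda>x. (r x - \<rho>) * tilted_weight \<gamma> x)"
    by (rule set_integrable_subset) auto
  have un: "{..<b} = {..<a} \<union> {a..<b}" using assms by auto
  show "excess_revenue r \<gamma> \<rho> b = excess_revenue r \<gamma> \<rho> a
    + (LINT x:{a..<b}|lborel. (r x - \<rho>) * tilted_weight \<gamma> x)"
    unfolding excess_revenue_def un
    by (rule set_integral_Un[OF _ excess_integrable[OF assms(1)] i]) auto
qed

text \<open>
  By monotonicity a loss at one negative point \<open>y\<close> persists on the whole interval \<open>(y - 1, y)\<close>, so it
  shows in the average.
\<close>
lemma threshold_revenue_less_1: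
  assumes "0 \<le> \<eta>" and loss: "y < 0" "r y < 1"
  shows "threshold_revenue r \<gamma> \<eta> < 1"
proof -
  have "set_integrable lborel {..<\<eta>} (\<lambda>x. - ((r x - 1) * tilted_weight \<gamma> x))"
    using excess_integrable[OF assms(1), of 1 \<gamma>] by (simp add: set_integrable_def)
  then have "0 < (LINT x:{..<\<eta>}|lborel. - ((r x - 1) * tilted_weight \<gamma> x))"
  proof (rule set_integral_pos_if_pos_on_interval)
    show "y - 1 < y" by simp
    show "{y - 1<..<y} \<subseteq> {..<\<eta>}" using assms by auto
    show "0 \<le> - ((r x - 1) * tilted_weight \<gamma> x)" for x
      using r_le_1[of x] tilted_weight_pos[of \<gamma> x] by (simp add: mult_le_0_iff)
    show "0 < - ((r x - 1) * tilted_weight \<gamma> x)" if "x < y" for x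
      using r_mono[of x y] loss that tilted_weight_pos[of \<gamma> x] by (simp add: mult_less_0_iff)
  qed
  then have "excess_revenue r \<gamma> 1 \<eta> < 0"
    by (simp add: excess_revenue_def set_lebesgue_integral_def)
  then show ?thesis
    using tilted_weight_integral_pos[OF assms(1), of \<gamma>]
    by (simp add: excess_revenue_eq[OF assms(1)] mult_less_0_iff)
qed

text \<open>
  If \<open>r x\<close> fell below the optimal revenue at some \<open>x < \<eta>\<close>, then \<open>r\<close> would stay below it on
  \<open>[x, \<eta>)\<close>, and the smaller threshold \<open>x\<close> would earn strictly more.
\<close>
lemma profile_ge_optimal_revenue:
  assumes opt: "optimal_threshold r \<gamma> \<eta>" and x: "0 \<le> x" "x < \<eta>"
  shows "threshold_revenue r \<gamma> \<eta> \<le> r x"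
proof (rule ccontr)
  let ?\<rho> = "threshold_revenue r \<gamma> \<eta>"
  assume "\<not> ?\<rho> \<le> r x"
  then have less: "r y < ?\<rho>" if "x \<le> y" for y
    using r_antimono[OF x(1) that] by simp
  let ?g = "\<lambda>x. (r x - ?\<rho>) * tilted_weight \<gamma> x"
  have "0 < (LINT y:{x..<\<eta>}|lborel. - ?g y)"
    using x less tilted_weight_pos excess_revenue_split(2)[of x \<eta> ?\<rho> \<gamma>]
    by (intro set_integral_pos_if_pos_on_interval[where a = x and b = \<eta>])
       (auto simp: set_integrable_def mult_le_0_iff mult_less_0_iff less_imp_le)
  also have "\<dots> = - (LINT y:{x..<\<eta>}|lborel. ?g y)"
    by (simp add: set_lebesgue_integral_def)
  finally have "0 < excess_revenue r \<gamma> ?\<rho> x"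
    using excess_revenue_split(1)[of x \<eta> \<gamma> ?\<rho>] excess_revenue_self[of \<eta> \<gamma>] x by simp
  then show False
    using excess_revenue_pos_iff[OF x(1)] optimal_threshold_maximal[OF opt, of x] by simp
qed

section \<open>Monotonicity in the tilt\<close>

text \<open>
  Since \<open>r - \<rho>\<close> changes sign at most once below \<open>\<eta>\<close>, from negative to positive, subtracting from the
  increasing function \<open>exp (\<delta> x)\<close> its value \<open>k\<close> at the crossing point makes the two signs agree.
  Strict positivity near \<open>0\<close> comes from \<open>r(0-) = 1 > \<rho>\<close>; it later turns this pointwise bound into a
  strict inequality of integrals.
\<close>
lemma single_crossing_factor:
  fixes \<delta> :: real
  assumes "0 < \<delta>" "\<rho> < 1" and above: "\<And>x. 0 \<le> x \<Longrightarrow> x < \<eta> \<Longrightarrow> \<rho> \<le> r x"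
  obtains k a where "a < 0" "\<And>x. x < \<eta> \<Longrightarrow> 0 \<le> (r x - \<rho>) * (exp (\<delta> * x) - k)"
    "\<And>x. a < x \<Longrightarrow> x < 0 \<Longrightarrow> 0 < (r x - \<rho>) * (exp (\<delta> * x) - k)"
proof -
  have "\<forall>\<^sub>F x in at_left 0. \<rho> < r x"
    using profile \<open>\<rho> < 1\<close> by (auto simp: revenue_profile_def intro: order_tendstoD)
  then obtain a where a: "a < 0" "\<And>x. a < x \<Longrightarrow> x < 0 \<Longrightarrow> \<rho> < r x"
    by (auto simp: eventually_at_left_field)
  show thesis
  proof (cases "\<exists>x\<le>0. r x < \<rho>")
    \<comment> \<open>Without a crossing, \<open>k = 0\<close> serves as the value of the exponential at \<open>- \<infinity>\<close>.\<close>
    case False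
    then have "\<rho> \<le> r x" if "x < \<eta>" for x
      using above[of x] that by (cases "x \<le> 0") auto
    then show ?thesis
      using a by (intro that[of a 0]) auto
  next
    case True
    define S where "S = {x. x \<le> 0 \<and> r x < \<rho>}"
    have S: "S \<noteq> {}" "bdd_above S"
      using True by (auto simp: S_def)
    have below: "x \<le> a" if "x \<in> S" for x
      using a(2)[of x] that r_zero \<open>\<rho> < 1\<close> by (cases "x = 0") (force simp: S_def)+
    have c: "Sup S \<le> a"
      using S below by (intro cSup_least) auto
    have right: "\<rho> \<le> r x" if "Sup S < x" "x < \<eta>" for x
    proof (cases "x \<le> 0")
      case True
      have "x \<notin> S" using cSup_upper[OF _ S(2), of x] that by auto
      then show ?thesis using True by (auto simp: S_def)
    qed (use above that in auto)
    have left: "r x \<le> \<rho>" if less: "x < Sup S" for x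
    proof -
      obtain y where "y \<in> S" "x < y" using less_cSupE[OF less S(1)] by blast
      then show ?thesis using r_mono[of x y] by (auto simp: S_def)
    qed
    show ?thesis
    proof (rule that[of a "exp (\<delta> * Sup S)"])
      fix x assume "x < \<eta>"
      consider "x < Sup S" | "x = Sup S" | "Sup S < x" by linarith
      then show "0 \<le> (r x - \<rho>) * (exp (\<delta> * x) - exp (\<delta> * Sup S))"
        using left[of x] right[of x] \<open>x < \<eta>\<close> \<open>0 < \<delta>\<close>
        by cases (auto intro!: mult_nonneg_nonneg mult_nonpos_nonpos)
    next
      fix x assume "a < x" "x < 0"
      then show "0 < (r x - \<rho>) * (exp (\<delta> * x) - exp (\<delta> * Sup S))"
        using a(2)[of x] c \<open>0 < \<delta>\<close> by (intro mult_pos_pos) auto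
    qed (use a in auto)
  qed
qed

text \<open>
  It suffices that the threshold \<open>\<eta>\<^sub>2\<close>, used at the parameter \<open>\<gamma>\<^sub>1\<close>, already earns more than the
  optimal revenue \<open>\<rho>\<close> at \<open>\<gamma>\<^sub>2\<close>.
  The two weights differ by the factor \<open>exp ((\<gamma>\<^sub>2 - \<gamma>\<^sub>1) x)\<close>.  Replacing it by
  \<open>exp ((\<gamma>\<^sub>2 - \<gamma>\<^sub>1) x) - k\<close> leaves the integral of \<open>r - \<rho>\<close> unchanged, because the excess over \<open>\<rho>\<close>
  vanishes at \<open>\<gamma>\<^sub>2\<close>, and for a suitable \<open>k\<close> it makes the integrand nonnegative.
\<close>
lemma optimal_revenue_strict_decreasing:
  assumes "\<gamma>\<^sub>1 < \<gamma>\<^sub>2" and opt1: "optimal_threshold r \<gamma>\<^sub>1 \<eta>\<^sub>1" and opt2: "optimal_threshold r \<gamma>\<^sub>2 \<eta>\<^sub>2"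
    and loss: "\<exists>x<0. r x < 1"
  shows "threshold_revenue r \<gamma>\<^sub>2 \<eta>\<^sub>2 < threshold_revenue r \<gamma>\<^sub>1 \<eta>\<^sub>1"
proof -
  let ?\<rho> = "threshold_revenue r \<gamma>\<^sub>2 \<eta>\<^sub>2"
  have \<eta>2: "0 \<le> \<eta>\<^sub>2" using opt2 by (simp add: optimal_threshold_def)
  have "?\<rho> < 1"
    using threshold_revenue_less_1[OF \<eta>2] loss by blast
  have "0 < \<gamma>\<^sub>2 - \<gamma>\<^sub>1" using \<open>\<gamma>\<^sub>1 < \<gamma>\<^sub>2\<close> by simp
  from this \<open>?\<rho> < 1\<close> profile_ge_optimal_revenue[OF opt2]
  obtain k a where a: "a < 0"
    and nonneg: "\<And>x. x < \<eta>\<^sub>2 \<Longrightarrow> 0 \<le> (r x - ?\<rho>) * (exp ((\<gamma>\<^sub>2 - \<gamma>\<^sub>1) * x) - k)"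
    and pos: "\<And>x. a < x \<Longrightarrow> x < 0 \<Longrightarrow> 0 < (r x - ?\<rho>) * (exp ((\<gamma>\<^sub>2 - \<gamma>\<^sub>1) * x) - k)"
    by (rule single_crossing_factor) blast+
  let ?g = "\<lambda>\<gamma> x. (r x - ?\<rho>) * tilted_weight \<gamma> x"
  have eq: "?g \<gamma>\<^sub>1 x - k * ?g \<gamma>\<^sub>2 x =
      (r x - ?\<rho>) * (exp ((\<gamma>\<^sub>2 - \<gamma>\<^sub>1) * x) - k) * tilted_weight \<gamma>\<^sub>2 x" for x
    by (subst tilted_weight_shift[of \<gamma>\<^sub>1 x \<gamma>\<^sub>2]) (simp add: algebra_simps)
  have int: "set_integrable lborel {..<\<eta>\<^sub>2} (?g \<gamma>)" for \<gamma>
    by (rule excess_integrable[OF \<eta>2])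
  have "0 < (LINT x:{..<\<eta>\<^sub>2}|lborel. ?g \<gamma>\<^sub>1 x - k * ?g \<gamma>\<^sub>2 x)"
  proof (rule set_integral_pos_if_pos_on_interval[OF _ _ a])
    show "set_integrable lborel {..<\<eta>\<^sub>2} (\<lambda>x. ?g \<gamma>\<^sub>1 x - k * ?g \<gamma>\<^sub>2 x)"
      using int by (intro set_integral_diff set_integrable_mult_right)
    show "0 \<le> ?g \<gamma>\<^sub>1 x - k * ?g \<gamma>\<^sub>2 x" if "x \<in> {..<\<eta>\<^sub>2}" for x
      unfolding eq using nonneg[of x] that tilted_weight_pos[of \<gamma>\<^sub>2 x] by simp
    show "0 < ?g \<gamma>\<^sub>1 x - k * ?g \<gamma>\<^sub>2 x" if "a < x" "x < 0" for x
      unfolding eq using pos[of x] that tilted_weight_pos[of \<gamma>\<^sub>2 x] by simp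
  qed (use \<eta>2 in auto)
  also have "\<dots> = excess_revenue r \<gamma>\<^sub>1 ?\<rho> \<eta>\<^sub>2 - k * excess_revenue r \<gamma>\<^sub>2 ?\<rho> \<eta>\<^sub>2"
    unfolding excess_revenue_def using int
    by (subst set_integral_diff) (auto intro!: set_integrable_mult_right)
  also have "\<dots> = excess_revenue r \<gamma>\<^sub>1 ?\<rho> \<eta>\<^sub>2"
    by (simp add: excess_revenue_self[OF \<eta>2])
  finally have "?\<rho> < threshold_revenue r \<gamma>\<^sub>1 \<eta>\<^sub>2"
    by (simp add: excess_revenue_pos_iff[OF \<eta>2])
  also have "\<dots> \<le> threshold_revenue r \<gamma>\<^sub>1 \<eta>\<^sub>1"
    by (rule optimal_threshold_maximal[OF opt1])
  finally show ?thesis .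
qed

text \<open>
  On \<open>[0, \<eta>\<^sub>1)\<close> the profile is at least the larger revenue, hence above the smaller one; stopping at
  some \<open>\<eta>\<^sub>2 < \<eta>\<^sub>1\<close> would forgo the gain on \<open>[\<eta>\<^sub>2, \<eta>\<^sub>1)\<close>.
\<close>
lemma optimal_threshold_le_if_revenue_less:
  assumes opt1: "optimal_threshold r \<gamma>\<^sub>1 \<eta>\<^sub>1" and opt2: "optimal_threshold r \<gamma>\<^sub>2 \<eta>\<^sub>2"
    and less: "threshold_revenue r \<gamma>\<^sub>2 \<eta>\<^sub>2 < threshold_revenue r \<gamma>\<^sub>1 \<eta>\<^sub>1"
  shows "\<eta>\<^sub>1 \<le> \<eta>\<^sub>2"
proof (rule ccontr)
  let ?\<rho> = "threshold_revenue r \<gamma>\<^sub>2 \<eta>\<^sub>2"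
  assume "\<not> \<eta>\<^sub>1 \<le> \<eta>\<^sub>2"
  then have \<eta>: "0 \<le> \<eta>\<^sub>2" "\<eta>\<^sub>2 < \<eta>\<^sub>1" using opt2 by (auto simp: optimal_threshold_def)
  have gt: "?\<rho> < r x" if "\<eta>\<^sub>2 \<le> x" "x < \<eta>\<^sub>1" for x
    using profile_ge_optimal_revenue[OF opt1, of x] less that \<eta> by simp
  have "0 < (LINT x:{\<eta>\<^sub>2..<\<eta>\<^sub>1}|lborel. (r x - ?\<rho>) * tilted_weight \<gamma>\<^sub>2 x)"
    using \<eta> gt tilted_weight_pos
    by (intro set_integral_pos_if_pos_on_interval[where a = \<eta>\<^sub>2 and b = \<eta>\<^sub>1] excess_revenue_split(2))
       (auto simp: less_imp_le)
  then have "0 < excess_revenue r \<gamma>\<^sub>2 ?\<rho> \<eta>\<^sub>1"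
    using excess_revenue_split(1)[of \<eta>\<^sub>2 \<eta>\<^sub>1 \<gamma>\<^sub>2 ?\<rho>] excess_revenue_self[of \<eta>\<^sub>2 \<gamma>\<^sub>2] \<eta> by simp
  then show False
    using excess_revenue_pos_iff[of \<eta>\<^sub>1] optimal_threshold_maximal[OF opt2, of \<eta>\<^sub>1] \<eta> by simp
qed

end

theorem proposition6:
  fixes r :: "real \<Rightarrow> real" and \<eta>opt :: "real \<Rightarrow> real" and \<Gamma> :: "real set"
  assumes "revenue_profile r"
    and "\<forall>\<gamma>\<in>\<Gamma>. optimal_threshold r \<gamma> (\<eta>opt \<gamma>)"
  shows "mono_on \<Gamma> \<eta>opt \<and>
    antimono_on \<Gamma> (\<lambda>\<gamma>. threshold_revenue r \<gamma> (\<eta>opt \<gamma>)) \<and>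
    ((\<forall>\<gamma>\<in>\<Gamma>. threshold_revenue r \<gamma> 0 < r 0) \<longrightarrow>
      strict_antimono_on \<Gamma> (\<lambda>\<gamma>. threshold_revenue r \<gamma> (\<eta>opt \<gamma>)) \<and>
      ((\<forall>\<gamma>\<in>\<Gamma>. r (\<eta>opt \<gamma>) = threshold_revenue r \<gamma> (\<eta>opt \<gamma>)) \<longrightarrow>
        strict_mono_on \<Gamma> \<eta>opt))"
proof -
  interpret unimodal_profile r by unfold_locales fact
  let ?\<rho> = "\<lambda>\<gamma>. threshold_revenue r \<gamma> (\<eta>opt \<gamma>)"
  note opt = assms(2)[rule_format]
  show ?thesis
  proof (cases "\<exists>x<0. r x < 1")
    case True
    have dec: "?\<rho> \<gamma>\<^sub>2 < ?\<rho> \<gamma>\<^sub>1" if "\<gamma>\<^sub>1 \<in> \<Gamma>" "\<gamma>\<^sub>2 \<in> \<Gamma>" "\<gamma>\<^sub>1 < \<gamma>\<^sub>2" for \<gamma>\<^sub>1 \<gamma>\<^sub>2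
      using optimal_revenue_strict_decreasing[OF that(3) opt opt True] that by blast
    have inc: "\<eta>opt \<gamma>\<^sub>1 \<le> \<eta>opt \<gamma>\<^sub>2" if "\<gamma>\<^sub>1 \<in> \<Gamma>" "\<gamma>\<^sub>2 \<in> \<Gamma>" "\<gamma>\<^sub>1 < \<gamma>\<^sub>2" for \<gamma>\<^sub>1 \<gamma>\<^sub>2
      using optimal_threshold_le_if_revenue_less[OF opt opt dec] that by blast
    have "mono_on \<Gamma> \<eta>opt" "antimono_on \<Gamma> ?\<rho>"
      using dec inc by (auto simp: monotone_on_def order_le_less)
    moreover have "strict_antimono_on \<Gamma> ?\<rho>"
      using dec by (auto simp: monotone_on_def)
    \<comment> \<open>Equal thresholds would have equal values of \<open>r\<close>, hence equal revenues.\<close>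
    moreover have "strict_mono_on \<Gamma> \<eta>opt" if "\<forall>\<gamma>\<in>\<Gamma>. r (\<eta>opt \<gamma>) = ?\<rho> \<gamma>"
      using dec inc that by (auto simp: monotone_on_def) (metis less_irrefl order_le_less)
    ultimately show ?thesis by blast
  next
    case False
    then have one: "r x = 1" if "x < 0" for x
      using r_le_1[of x] that by (meson order_le_less)
    have at_zero: "threshold_revenue r \<gamma> 0 = 1" for \<gamma>
    proof -
      have "(LINT x:{..<0}|lborel. r x * tilted_weight \<gamma> x) = (LINT x:{..<0}|lborel. tilted_weight \<gamma> x)"
        by (intro set_lebesgue_integral_cong) (auto simp: one)
      then show ?thesis
        using tilted_weight_integral_pos[of 0 \<gamma>] by (simp add: threshold_revenue_average)
    qed
    then have "\<eta>opt \<gamma> = 0" if "\<gamma> \<in> \<Gamma>" for \<gamma>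
      using opt[OF that] by (simp add: optimal_threshold_def r_zero)
    then show ?thesis
      by (auto simp: monotone_on_def at_zero r_zero)
  qed
qed

end
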